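(* Let $G$ be a finite simple undirected graph with at least one vertex. Then $$\dim_{EHT}(G)\le 2\,(\dim(G)+1)\cdot \lfloor\log_2(|G|)\rfloor,$$ where $\dim_{EHT}(G)$ and $\dim(G)$ are the two notions of dimension of a graph defined in the context.
   Context: All graphs are finite, simple and undirected; $|G|$ denotes the number of vertices of a graph $G$. For a graph $H$, let $\delta(H)=\max_{x\in V(H)}\deg_H(x)$ denote its maximum degree. For a nonempty graph $G'$ define its sub-dimension $$\mathrm{subdim}(G')=\min_{G''}\ \delta(G''),$$ where the minimum is over all induced subgraphs $G''=(V'',E'')$ of $G'$ (i.e. $E''$ consists of all edges of $G'$ with both endpoints in $V''$) with $|V''|\ge \lfloor |G'|/2\rfloor+1$. The dimension of a nonempty graph $G$ is $$\dim(G)=\max_{G'}\ \mathrm{subdim}(G'),$$ where the maximum is over all induced subgraphs $G'$ of $G$ on a nonempty vertex set. The Erdős–Harary–Tutte dimension $\dim_{EHT}(G)$ is the least integer $d\ge 0$ such that there is an injective map $f:V(G)\to\mathbb{R}^d$ with $\|f(x)-f(y)\|=1$ (Euclidean norm) for every edge $xy$ of $G$ (edges are allowed to cross, and non-adjacent vertices may also be at distance 1). *)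

theory Defs
  imports "HOL-Analysis.Analysis" "Graph_Theory.Digraph_Component"
begin

text \<open>
  Finite simple undirected graphs are the loop-free symmetric digraphs without parallel arcs
  of locale \<^locale>\<open>Digraph.graph\<close>: an undirected edge is a pair of opposite arcs, so the
  degree of a vertex is its out-degree.
\<close>

definition max_degree :: "('a, 'b) pre_digraph \<Rightarrow> nat" where
  "max_degree H = Max (out_degree H ` verts H)"

text \<open>
  For a graph with at least one vertex the sets below are finite and nonempty and contain only
  values of nonempty graphs, so no \<^const>\<open>Min\<close> or \<^const>\<open>Max\<close> is degenerate.
\<close>

definition subdim :: "('a, 'b) pre_digraph \<Rightarrow> nat" where
  "subdim G = Min {max_degree H | H. induced_subgraph H G \<and>
     card (verts H) \<ge> card (verts G) div 2 + 1}"

definition graph_dim :: "('a, 'b) pre_digraph \<Rightarrow> nat" where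
  "graph_dim G = Max {subdim H | H. induced_subgraph H G \<and> verts H \<noteq> {}}"

text \<open>
  The points of \<^term>\<open>Euclidean_space d\<close> are the real sequences that vanish from index
  \<^term>\<open>d\<close> on.
\<close>

definition unit_distance_embedding ::
  "('a, 'b) pre_digraph \<Rightarrow> nat \<Rightarrow> ('a \<Rightarrow> nat \<Rightarrow> real) \<Rightarrow> bool" where
  "unit_distance_embedding G d f \<longleftrightarrow>
     f ` verts G \<subseteq> topspace (Euclidean_space d) \<and>
     inj_on f (verts G) \<and>
     (\<forall>x y. x \<rightarrow>\<^bsub>G\<^esub> y \<longrightarrow> L2_set (\<lambda>i. f x i - f y i) {..<d} = 1)"

definition EHT_dim :: "('a, 'b) pre_digraph \<Rightarrow> nat" where
  "EHT_dim G = (LEAST d. \<exists>f. unit_distance_embedding G d f)"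

end

theory Submission
  imports Defs
begin

text \<open>
  Vertices are placed on the sphere of radius \<open>1/\<surd>2\<close> about the origin, where unit distance
  means orthogonality. Hence representations of two disjoint vertex sets combine in the direct sum
  of the ambient spaces, and an independent set fits on a circle. With \<open>d = graph_dim G\<close>, every
  vertex set \<open>S\<close> contains more than half of itself in a subset inducing maximum degree at most
  \<open>d\<close>, hence one that is greedily \<open>(d + 1)\<close>-colourable and so representable in \<open>2 (d + 1)\<close>
  dimensions. Peeling off such subsets brings \<open>2 ^ (k + 1) - 1\<close> vertices down to at most three
  in \<open>k - 1\<close> rounds. As \<open>d \<ge> 1\<close> once there is an edge, the last three vertices fit in the
  remaining \<open>2 (d + 1) \<ge> 3\<close> dimensions as multiples of basis vectors; colouring them as well
  would cost one round too many when \<open>|G|\<close> is one less than a power of two.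
\<close>

section \<open>Spherical representations and how to build them\<close>

definition spherical_rep ::
  "('a \<Rightarrow> 'a \<Rightarrow> bool) \<Rightarrow> 'a set \<Rightarrow> nat \<Rightarrow> ('a \<Rightarrow> nat \<Rightarrow> real) \<Rightarrow> bool" where
  "spherical_rep E S m f \<longleftrightarrow>
     (\<forall>x\<in>S. (\<forall>i\<ge>m. f x i = 0) \<and> (\<Sum>i<m. (f x i)\<^sup>2) = 1/2) \<and>
     inj_on f S \<and>
     (\<forall>x\<in>S. \<forall>y\<in>S. E x y \<longrightarrow> (\<Sum>i<m. f x i * f y i) = 0)"

lemma sum_lessThan_add:
  fixes g :: "nat \<Rightarrow> 'a::comm_monoid_add"
  shows "(\<Sum>i<m+p. g i) = (\<Sum>i<m. g i) + (\<Sum>i<p. g (m + i))"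
  by (induction p) (auto simp: add.assoc)

text \<open>Points of \<open>S\<close> keep the first \<open>m\<close> coordinates and points of
  \<open>T\<close> are shifted past them. The supports are disjoint, so the two families are
  orthogonal whatever \<open>E\<close> says between \<open>S\<close> and \<open>T\<close>.\<close>

lemma spherical_rep_join:
  assumes f: "spherical_rep E S m f" and g: "spherical_rep E T p g" and disj: "S \<inter> T = {}"
  shows "\<exists>h. spherical_rep E (S \<union> T) (m + p) h"
proof -
  define h where "h = (\<lambda>x i. if x \<in> S then f x i else if i < m then 0 else g x (i - m))"
  have hS: "h x = f x" if "x \<in> S" for x
    using that by (auto simp: h_def)
  have hT: "h x = (\<lambda>i. if i < m then 0 else g x (i - m))" if "x \<in> T" for x
    using that disj by (auto simp: h_def fun_eq_iff)
  have f0: "f x i = 0" if "x \<in> S" "i \<ge> m" for x i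
    using f that by (auto simp: spherical_rep_def)
  have g0: "g x i = 0" if "x \<in> T" "i \<ge> p" for x i
    using g that by (auto simp: spherical_rep_def)
  have fn: "(\<Sum>i<m. (f x i)\<^sup>2) = 1/2" if "x \<in> S" for x
    using f that by (auto simp: spherical_rep_def)
  have gn: "(\<Sum>i<p. (g x i)\<^sup>2) = 1/2" if "x \<in> T" for x
    using g that by (auto simp: spherical_rep_def)
  have supp: "\<forall>i\<ge>m+p. h x i = 0" if "x \<in> S \<union> T" for x
    using that by (auto simp: hS hT f0 g0)
  have norm: "(\<Sum>i<m+p. (h x i)\<^sup>2) = 1/2" if "x \<in> S \<union> T" for x
    using that by (auto simp: hS hT f0 fn gn sum_lessThan_add)
  \<comment> \<open>Equality would make the first \<open>m\<close> coordinates of \<open>f x\<close>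
    vanish, against its squared norm 1/2.\<close>
  have cross: "h x \<noteq> h y" if "x \<in> S" "y \<in> T" for x y
  proof
    assume "h x = h y"
    then have "\<forall>i<m. f x i = 0"
      by (metis hS hT that)
    then show False
      using fn[OF \<open>x \<in> S\<close>] by simp
  qed
  have injT: "x = y" if "x \<in> T" "y \<in> T" "h x = h y" for x y
  proof -
    have "g x i = g y i" for i
      using fun_cong[OF that(3), of "m + i"] by (simp add: hT that(1,2))
    then have "g x = g y"
      by blast
    then show ?thesis
      using g that by (auto simp: spherical_rep_def inj_on_def)
  qed
  have inj: "inj_on h (S \<union> T)"
  proof (rule inj_onI)
    fix x y assume "x \<in> S \<union> T" "y \<in> S \<union> T" "h x = h y"
    moreover have "x = y" if "x \<in> S" "y \<in> S" "h x = h y"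
      using f that by (auto simp: spherical_rep_def hS inj_on_def)
    ultimately show "x = y"
      using cross[of x y] cross[of y x] injT by auto
  qed
  have orth: "(\<Sum>i<m+p. h x i * h y i) = 0" if "x \<in> S \<union> T" "y \<in> S \<union> T" "E x y" for x y
    using that f g by (auto simp: hS hT f0 sum_lessThan_add spherical_rep_def)
  show ?thesis
    using supp norm inj orth by (intro exI[of _ h]) (auto simp: spherical_rep_def)
qed

text \<open>Distinct vertices get distinct scaled basis vectors, so all pairs are orthogonal and
  \<open>E\<close> only has to be irreflexive.\<close>

lemma spherical_rep_small:
  assumes "finite S" "card S \<le> m" and irr: "\<And>x. \<not> E x x"
  shows "\<exists>f. spherical_rep E S m f"
proof -
  obtain c :: "'a \<Rightarrow> nat" where c: "inj_on c S" "c ` S = {0..<card S}"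
    using ex_bij_betw_finite_nat[OF \<open>finite S\<close>] by (auto simp: bij_betw_def)
  have cm: "c x < m" if "x \<in> S" for x
  proof -
    have "c x \<in> {0..<card S}"
      using c(2) that by blast
    then show ?thesis
      using assms(2) by simp
  qed
  define f :: "'a \<Rightarrow> nat \<Rightarrow> real" where "f = (\<lambda>x i. if i = c x then sqrt (1/2) else 0)"
  have "(\<Sum>i<m. (f x i)\<^sup>2) = 1/2" if "x \<in> S" for x
  proof -
    have "(f x i)\<^sup>2 = (if i = c x then 1/2 else 0)" for i
      by (simp add: f_def)
    then show ?thesis
      using cm[OF that] by simp
  qed
  moreover have "inj_on f S"
  proof (rule inj_onI)
    fix x y assume "x \<in> S" "y \<in> S" "f x = f y"
    then have "f y (c x) = sqrt (1/2)"
      by (metis f_def)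
    then have "c x = c y"
      by (auto simp: f_def split: if_splits)
    then show "x = y"
      using c \<open>x \<in> S\<close> \<open>y \<in> S\<close> by (auto simp: inj_on_def)
  qed
  moreover have "(\<Sum>i<m. f x i * f y i) = 0" if "x \<in> S" "y \<in> S" "E x y" for x y
  proof -
    have "c x \<noteq> c y"
      using that irr c by (auto simp: inj_on_def)
    then show ?thesis
      by (intro sum.neutral) (auto simp: f_def)
  qed
  moreover have "f x i = 0" if "x \<in> S" "i \<ge> m" for x i
    using that cm[of x] by (auto simp: f_def)
  ultimately show ?thesis
    by (intro exI[of _ f]) (auto simp: spherical_rep_def)
qed

text \<open>Each colour owns a coordinate plane, and its vertices sit on the circle in that plane.
  Adjacent vertices lie in orthogonal planes; within a colour only distinctness is at stake.\<close>

lemma spherical_rep_of_colouring: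
  assumes "finite S" and col: "\<And>x. x \<in> S \<Longrightarrow> c x < q"
    and proper: "\<And>x y. x \<in> S \<Longrightarrow> y \<in> S \<Longrightarrow> E x y \<Longrightarrow> c x \<noteq> c y"
  shows "\<exists>f. spherical_rep E S (2 * q) f"
proof -
  obtain e :: "'a \<Rightarrow> nat" where e: "inj_on e S"
    using finite_imp_inj_to_nat_seg[OF \<open>finite S\<close>] by auto
  \<comment> \<open>The first plane coordinate: it identifies \<open>x\<close>, is positive, and its
    square is small enough for the second coordinate, a square root, to complete the squared norm to
    1/2.\<close>
  define t :: "'a \<Rightarrow> real" where "t = (\<lambda>x. 1 / (2 + real (e x)))"
  have tpos: "t x > 0" for x
    by (simp add: t_def)
  have tsq: "(t x)\<^sup>2 \<le> 1/2" for x
  proof -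
    have "t x \<le> 1/2"
      by (simp add: t_def field_simps)
    then have "(t x)\<^sup>2 \<le> (1/2)\<^sup>2"
      using tpos[of x] by (intro power_mono) auto
    then show ?thesis
      by (simp add: power2_eq_square)
  qed
  define f where "f = (\<lambda>x i. if i = 2 * c x then t x
      else if i = Suc (2 * c x) then sqrt (1/2 - (t x)\<^sup>2) else 0)"
  have "(\<Sum>i<2 * q. (f x i)\<^sup>2) = 1/2" if "x \<in> S" for x
  proof -
    have "(\<Sum>i<2 * q. (f x i)\<^sup>2) = (\<Sum>i\<in>{2 * c x, Suc (2 * c x)}. (f x i)\<^sup>2)"
      using col[OF that] by (intro sum.mono_neutral_right) (auto simp: f_def)
    also have "\<dots> = 1/2"
      using tsq[of x] by (simp add: f_def)
    finally show ?thesis .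
  qed
  moreover have "inj_on f S"
  proof (rule inj_onI)
    fix x y assume xy: "x \<in> S" "y \<in> S" "f x = f y"
    then have *: "f y (2 * c x) = t x"
      by (metis f_def)
    \<comment> \<open>By parity, index \<open>2 * c x\<close> is never the second slot of
      \<open>y\<close>. As \<open>f y\<close> takes the nonzero value \<open>t x\<close> there, it
      must be the first slot of \<open>y\<close>.\<close>
    have "2 * c x \<noteq> Suc (2 * c y)"
      by presburger
    then have "t x = t y"
      using * tpos[of x] by (auto simp: f_def split: if_splits)
    then have "e x = e y"
      by (simp add: t_def)
    then show "x = y"
      using e xy by (auto simp: inj_on_def)
  qed
  moreover have "(\<Sum>i<2 * q. f x i * f y i) = 0" if "x \<in> S" "y \<in> S" "E x y" for x y
  proof -
    have "c x \<noteq> c y"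
      using proper that by blast
    moreover have "2 * c x \<noteq> Suc (2 * c y)" "Suc (2 * c x) \<noteq> 2 * c y"
      by presburger+
    ultimately show ?thesis
      by (intro sum.neutral) (auto simp: f_def)
  qed
  moreover have "f x i = 0" if "x \<in> S" "i \<ge> 2 * q" for x i
    using that col[of x] by (auto simp: f_def)
  ultimately show ?thesis
    by (intro exI[of _ f]) (auto simp: spherical_rep_def)
qed

section \<open>Colouring and peeling\<close>

lemma greedy_colouring:
  assumes "finite T" and sym: "\<And>x y. E x y \<Longrightarrow> E y x" and irr: "\<And>x. \<not> E x x"
    and deg: "\<And>x. x \<in> T \<Longrightarrow> card {y \<in> T. E x y} \<le> d"
  shows "\<exists>c :: 'a \<Rightarrow> nat. (\<forall>x\<in>T. c x < d + 1) \<and> (\<forall>x\<in>T. \<forall>y\<in>T. E x y \<longrightarrow> c x \<noteq> c y)"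
  using assms(1) deg
proof (induction T rule: finite_induct)
  case empty
  then show ?case by simp
next
  case (insert a T)
  have "card {y \<in> T. E x y} \<le> d" if "x \<in> T" for x
  proof -
    have "card {y \<in> T. E x y} \<le> card {y \<in> insert a T. E x y}"
      using insert.hyps by (intro card_mono) auto
    then show ?thesis
      using insert.prems[of x] that by auto
  qed
  then obtain c :: "'a \<Rightarrow> nat" where c: "\<forall>x\<in>T. c x < d + 1"
      "\<forall>x\<in>T. \<forall>y\<in>T. E x y \<longrightarrow> c x \<noteq> c y"
    using insert.IH by blast
  let ?N = "{y \<in> insert a T. E a y}"
  have "card (c ` ?N) \<le> d"
    using card_image_le[of ?N c] insert.hyps insert.prems[of a] by auto
  \<comment> \<open>The neighbours of \<open>a\<close> use at most \<open>d\<close> of the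
    \<open>d + 1\<close> colours, so one is free for \<open>a\<close>.\<close>
  then have "\<not> {..<d + 1} \<subseteq> c ` ?N"
    using card_mono[of "c ` ?N" "{..<d + 1}"] insert.hyps by auto
  then obtain k where k: "k < d + 1" "k \<notin> c ` ?N"
    by blast
  have "\<forall>x\<in>insert a T. (c(a := k)) x < d + 1"
    using c k by auto
  moreover have "(c(a := k)) x \<noteq> (c(a := k)) y"
    if "x \<in> insert a T" "y \<in> insert a T" "E x y" for x y
    using that c(2) k(2) irr sym[OF that(3)] by (cases "x = a"; cases "y = a") auto
  ultimately show ?case
    by blast
qed

lemma spherical_rep_exists:
  assumes sym: "\<And>x y. E x y \<Longrightarrow> E y x" and irr: "\<And>x. \<not> E x x"
    and half: "\<And>S. S \<subseteq> V \<Longrightarrow> S \<noteq> {} \<Longrightarrow>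
      \<exists>T\<subseteq>S. card S div 2 + 1 \<le> card T \<and> (\<forall>x\<in>T. card {y \<in> T. E x y} \<le> d)"
    and "finite V" "d \<ge> 1" "k \<ge> 1"
  shows "S \<subseteq> V \<Longrightarrow> card S < 2 ^ (k + 1) \<Longrightarrow> \<exists>f. spherical_rep E S (2 * (d + 1) * k) f"
  using \<open>k \<ge> 1\<close>
proof (induction k arbitrary: S rule: dec_induct)
  \<comment> \<open>Here \<open>card S\<close> is at most 3, while \<open>d \<ge> 1\<close> gives at
    least 4 dimensions.\<close>
  case base
  then show ?case
    using \<open>finite V\<close> \<open>d \<ge> 1\<close> irr by (intro spherical_rep_small) (auto intro: finite_subset)
next
  case (step k)
  have fin: "finite S"
    using step.prems \<open>finite V\<close> finite_subset by blast
  show ?case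
  proof (cases "S = {}")
    case True
    then show ?thesis by (auto simp: spherical_rep_def)
  next
    case False
    then obtain T where T: "T \<subseteq> S" "card S div 2 + 1 \<le> card T"
        "\<forall>x\<in>T. card {y \<in> T. E x y} \<le> d"
      using half step.prems by blast
    have finT: "finite T"
      using T fin finite_subset by blast
    obtain c :: "'a \<Rightarrow> nat" where "\<forall>x\<in>T. c x < d + 1"
        "\<forall>x\<in>T. \<forall>y\<in>T. E x y \<longrightarrow> c x \<noteq> c y"
      using greedy_colouring[of T E d, OF finT sym irr] T(3) by blast
    then obtain f where f: "spherical_rep E T (2 * (d + 1)) f"
      using spherical_rep_of_colouring[OF finT, of c "d + 1" E] by blast
    have "card (S - T) = card S - card T"
      using T finT by (simp add: card_Diff_subset)
    \<comment> \<open>The \<open>+ 1\<close> in the size of \<open>T\<close> is essential: if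
      \<open>card S\<close> is \<open>2 ^ (k + 2) - 1\<close>, removing only
      \<open>card S div 2\<close> vertices would leave exactly \<open>2 ^ (k + 1)\<close>.\<close>
    then have "card (S - T) < 2 ^ (k + 1)"
      using T(2) step.prems by auto
    then obtain g where g: "spherical_rep E (S - T) (2 * (d + 1) * k) g"
      using step.IH step.prems by blast
    have "T \<union> (S - T) = S" "T \<inter> (S - T) = {}"
      using T by blast+
    moreover have "2 * (d + 1) + 2 * (d + 1) * k = 2 * (d + 1) * Suc k"
      by simp
    ultimately show ?thesis
      using spherical_rep_join[OF f g] by metis
  qed
qed

section \<open>Passage to digraphs and their two dimensions\<close>

lemma unit_distance_embedding_of_spherical_rep:
  assumes "wf_digraph G" and f: "spherical_rep (\<lambda>x y. x \<rightarrow>\<^bsub>G\<^esub> y) (verts G) m f"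
  shows "unit_distance_embedding G m f"
proof -
  have "L2_set (\<lambda>i. f x i - f y i) {..<m} = 1" if "x \<rightarrow>\<^bsub>G\<^esub> y" for x y
  proof -
    have xy: "x \<in> verts G" "y \<in> verts G"
      using wf_digraph.adj_in_verts[OF assms(1) that] by auto
    have norm: "(\<Sum>i<m. (f z i)\<^sup>2) = 1/2" if "z \<in> verts G" for z
      using f that by (auto simp: spherical_rep_def)
    have orth: "(\<Sum>i<m. f x i * f y i) = 0"
      using f xy that by (auto simp: spherical_rep_def)
    have "(\<Sum>i<m. (f x i - f y i)\<^sup>2) =
        (\<Sum>i<m. (f x i)\<^sup>2) + (\<Sum>i<m. (f y i)\<^sup>2) - 2 * (\<Sum>i<m. f x i * f y i)"
      by (simp add: power2_diff sum.distrib sum_subtractf sum_distrib_left mult.assoc)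
    also have "\<dots> = 1"
      by (simp add: norm orth xy)
    finally show ?thesis
      by (simp add: L2_set_def)
  qed
  then show ?thesis
    using f by (auto simp: unit_distance_embedding_def spherical_rep_def topspace_Euclidean_space)
qed

lemma induced_subgraph_eq_induce:
  assumes "induced_subgraph H G"
  shows "H = G \<restriction> verts H"
  using assms
  by (intro pre_digraph.equality) (auto simp: induced_subgraph_def subgraph_def compatible_def)

text \<open>Compatibility fixes the \<open>tail\<close> and \<open>head\<close> functions, so an
  induced subgraph is determined by its vertex set. This finiteness justifies reasoning about the
  \<open>Min\<close> and \<open>Max\<close> in the definitions.\<close>

lemma finite_induced_subgraphs:
  assumes "finite (verts G)"
  shows "finite {H. induced_subgraph H G}"
proof (rule finite_subset)
  show "{H. induced_subgraph H G} \<subseteq> (\<lambda>S. G \<restriction> S) ` Pow (verts G)"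
  proof
    fix H assume "H \<in> {H. induced_subgraph H G}"
    then show "H \<in> (\<lambda>S. G \<restriction> S) ` Pow (verts G)"
      using induced_subgraph_eq_induce[of H G]
      by (intro image_eqI[of _ _ "verts H"]) (auto simp: induced_subgraph_def subgraph_def)
  qed
qed (use assms in simp)

text \<open>The subgraph induced on \<open>S\<close> competes in the maximum defining
  \<open>graph_dim G\<close>. A subgraph \<open>K\<close> attaining its \<open>subdim\<close>
  supplies \<open>T\<close>.\<close>

lemma (in fin_digraph) large_subset_of_small_degree:
  assumes "S \<subseteq> verts G" "S \<noteq> {}"
  shows "\<exists>T\<subseteq>S. card S div 2 + 1 \<le> card T \<and> (\<forall>x\<in>T. card {y \<in> T. x \<rightarrow>\<^bsub>G\<^esub> y} \<le> graph_dim G)"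
proof -
  have finS: "finite S"
    using assms finite_subset finite_verts by blast
  define H where "H = G \<restriction> S"
  have vH [simp]: "verts H = S"
    by (simp add: H_def)
  have H: "induced_subgraph H G"
    using assms by (simp add: H_def induced_induce)
  interpret H: wf_digraph H
    using H by (auto simp: induced_subgraph_def subgraph_def)
  have "finite {subdim H | H. induced_subgraph H G \<and> verts H \<noteq> {}}"
    by (rule finite_subset[OF _ finite_imageI[OF finite_induced_subgraphs[of G], of subdim]]) auto
  then have le: "subdim H \<le> graph_dim G"
    unfolding graph_dim_def using H assms by (intro Max_ge) auto
  let ?D = "{max_degree K | K. induced_subgraph K H \<and> card (verts H) div 2 + 1 \<le> card (verts K)}"
  have "finite ?D"
    by (rule finite_subset[OF _ finite_imageI[OF finite_induced_subgraphs[of H], of max_degree]])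
       (use finS in auto)
  moreover have "card S > 0"
    using assms finS by (simp add: card_gt_0_iff)
  then have "card S div 2 + 1 \<le> card S"
    by linarith
  \<comment> \<open>As \<open>S\<close> is nonempty, \<open>H\<close> itself is large enough to
    compete, so the minimum is attained.\<close>
  then have "max_degree H \<in> ?D"
    using H.induced_subgraph_refl by (intro CollectI exI[of _ H]) simp
  then have "?D \<noteq> {}"
    by blast
  ultimately have "subdim H \<in> ?D"
    unfolding subdim_def by (rule Min_in)
  then obtain K where K: "induced_subgraph K H" "card S div 2 + 1 \<le> card (verts K)"
      "subdim H = max_degree K"
    by auto
  have sub: "verts K \<subseteq> S"
    using K(1) by (auto simp: induced_subgraph_def subgraph_def)
  then have finK: "finite (verts K)"
    using finS finite_subset by blast
  have K_eq: "K = H \<restriction> verts K"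
    by (rule induced_subgraph_eq_induce[OF K(1)])
  have tailK: "tail K = tail G" and headK: "head K = head G"
    by (subst K_eq, simp add: H_def)+
  have arcsK: "arcs K = {e \<in> arcs G. tail G e \<in> verts K \<and> head G e \<in> verts K}"
    by (subst K_eq) (use sub in \<open>auto simp: H_def\<close>)
  have "card {y \<in> verts K. x \<rightarrow>\<^bsub>G\<^esub> y} \<le> graph_dim G" if x: "x \<in> verts K" for x
  proof -
    have "finite (out_arcs K x)"
      by (rule finite_subset[OF _ finite_arcs]) (auto simp: arcsK)
    \<comment> \<open>Every neighbour of \<open>x\<close> in \<open>K\<close> is the head of an arc
      leaving \<open>x\<close>, so out-degree bounds the number of neighbours.\<close>
    moreover have "{y \<in> verts K. x \<rightarrow>\<^bsub>G\<^esub> y} \<subseteq> head G ` out_arcs K x"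
      using x by (auto simp: arcs_ends_conv arcsK tailK)
    ultimately have "card {y \<in> verts K. x \<rightarrow>\<^bsub>G\<^esub> y} \<le> out_degree K x"
      unfolding out_degree_def by (rule surj_card_le)
    also have "\<dots> \<le> max_degree K"
      unfolding max_degree_def using finK x by (intro Max_ge) auto
    finally show ?thesis
      using K(3) le by simp
  qed
  then show ?thesis
    using K(2) sub by blast
qed

lemma (in Digraph.graph) graph_dim_pos:
  assumes "x \<rightarrow>\<^bsub>G\<^esub> y"
  shows "graph_dim G \<ge> 1"
proof -
  have xy: "x \<in> verts G" "y \<in> verts G" "x \<noteq> y"
    using adj_in_verts[OF assms] adj_not_same assms by auto
  obtain T where T: "T \<subseteq> {x, y}" "card {x, y} div 2 + 1 \<le> card T"
      "\<forall>v\<in>T. card {w \<in> T. v \<rightarrow>\<^bsub>G\<^esub> w} \<le> graph_dim G"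
    using large_subset_of_small_degree[of "{x, y}"] xy by auto
  \<comment> \<open>More than half of two vertices means both, so the edge survives in
    \<open>T\<close>.\<close>
  have "T = {x, y}"
    using T xy by (intro card_seteq) auto
  then have "card {y} \<le> card {w \<in> T. x \<rightarrow>\<^bsub>G\<^esub> w}"
    using assms by (intro card_mono) auto
  also have "\<dots> \<le> graph_dim G"
    using T \<open>T = {x, y}\<close> by simp
  finally show ?thesis
    by simp
qed

theorem corollary3p6:
  fixes G :: "('a, 'b) pre_digraph"
  assumes "Digraph.graph G"
    and "verts G \<noteq> {}"
  shows "int (EHT_dim G) \<le> 2 * (int (graph_dim G) + 1) * \<lfloor>log 2 (real (card (verts G)))\<rfloor>"
proof -
  interpret G: Digraph.graph G
    by fact
  define n where "n = card (verts G)"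
  define d where "d = graph_dim G"
  define k where "k = nat \<lfloor>log 2 (real n)\<rfloor>"
  have n: "n \<ge> 1"
    using assms(2) by (simp add: n_def Suc_le_eq card_gt_0_iff)
  then have k: "\<lfloor>log 2 (real n)\<rfloor> = int k"
    by (simp add: k_def)
  then have less: "n < 2 ^ (k + 1)"
    using floor_log_nat_eq_powr_iff[of 2 n k] n by simp
  \<comment> \<open>An upper bound on \<open>m\<close> suffices for the least dimension, and the
    edgeless cases use fewer coordinates.\<close>
  have "\<exists>m f. m \<le> 2 * (d + 1) * k \<and> unit_distance_embedding G m f"
  proof (cases "\<exists>x y. x \<rightarrow>\<^bsub>G\<^esub> y")
    case True
    then obtain x y where xy: "x \<rightarrow>\<^bsub>G\<^esub> y"
      by blast
    have "d \<ge> 1"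
      using G.graph_dim_pos[OF xy] by (simp add: d_def)
    have "card {x, y} \<le> n"
      unfolding n_def using G.adj_in_verts[OF xy] by (intro card_mono) auto
    \<comment> \<open>An edge forces \<open>n \<ge> 2\<close>, whereas \<open>k = 0\<close> would
      give \<open>n < 2\<close>.\<close>
    then have "k \<ge> 1"
      using less G.adj_not_same xy by (cases k; cases "x = y") auto
    have "\<exists>f. spherical_rep (\<lambda>x y. x \<rightarrow>\<^bsub>G\<^esub> y) (verts G) (2 * (d + 1) * k) f"
    proof (rule spherical_rep_exists)
      show "\<And>x y. x \<rightarrow>\<^bsub>G\<^esub> y \<Longrightarrow> y \<rightarrow>\<^bsub>G\<^esub> x"
        using G.sym_arcs by (auto simp: symmetric_def dest: symD)
      show "\<And>x. \<not> x \<rightarrow>\<^bsub>G\<^esub> x"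
        using G.adj_not_same by blast
      show "\<exists>T\<subseteq>S. card S div 2 + 1 \<le> card T \<and> (\<forall>x\<in>T. card {y \<in> T. x \<rightarrow>\<^bsub>G\<^esub> y} \<le> d)"
        if "S \<subseteq> verts G" "S \<noteq> {}" for S
        unfolding d_def using that by (rule G.large_subset_of_small_degree)
    qed (use \<open>d \<ge> 1\<close> \<open>k \<ge> 1\<close> less in \<open>auto simp: n_def\<close>)
    then show ?thesis
      using unit_distance_embedding_of_spherical_rep[OF G.wf_digraph] by blast
  next
    case no_arcs: False
    show ?thesis
    \<comment> \<open>Without edges only injectivity matters. For \<open>n = 1\<close> the bound is
      0 and the origin suffices; otherwise \<open>k \<ge> 1\<close> leaves room for distinct points
      on a line.\<close>
    proof (cases "n = 1")
      case True
      then obtain v where "verts G = {v}"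
        by (auto simp: n_def card_1_singleton_iff)
      then have "unit_distance_embedding G 0 (\<lambda>_ _. 0)"
        using no_arcs by (auto simp: unit_distance_embedding_def topspace_Euclidean_space)
      then show ?thesis
        by blast
    next
      case False
      then have "k \<ge> 1"
        using less n by (cases k) auto
      obtain e :: "'a \<Rightarrow> nat" where "inj_on e (verts G)"
        using finite_imp_inj_to_nat_seg[OF G.finite_verts] by auto
      then have "inj_on (\<lambda>x i. if i = 0 then real (e x) else 0) (verts G)"
        by (auto simp: inj_on_def fun_eq_iff)
      then have "unit_distance_embedding G 1 (\<lambda>x i. if i = 0 then real (e x) else 0)"
        using no_arcs by (auto simp: unit_distance_embedding_def topspace_Euclidean_space)
      moreover have "1 \<le> 2 * (d + 1) * k"
        using \<open>k \<ge> 1\<close> by simp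
      ultimately show ?thesis
        by blast
    qed
  qed
  then have "EHT_dim G \<le> 2 * (d + 1) * k"
    unfolding EHT_dim_def by (metis (mono_tags, lifting) Least_le order_trans)
  then have "int (EHT_dim G) \<le> int (2 * (d + 1) * k)"
    by (simp only: of_nat_le_iff)
  then show ?thesis
    using k by (simp add: d_def n_def algebra_simps)
qed

end
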